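(* For every integer $n\ge0$ and $\beta\in\mathbb{C}$, with $H_n^{\beta}=F_nE^{n\beta}F_n^{-1}$ (a linear map on polynomials of degree at most $n$), one has $$H_n^{-\beta}=J_nH_n^{\beta}J_n .$$
   Context: Polynomials over $\mathbb{C}$. $F_n$ is the linear map on polynomials of degree at most $n$ with $F_nx^p=(1-x)^{2n+1}\sum_{m\ge0}m^p\binom{m+n}{n}x^m$ ($0^0=1$), inverse $F_n^{-1}x^p=\frac{n!}{(2n)!}(x)_p[x+n+1]_{n-p}$, where $(y)_p=y(y-1)\cdots(y-p+1)$, $[y]_k=y(y+1)\cdots(y+k-1)$. $E^{\gamma}c(x)=c(x+\gamma)$. $J_nc(x)=x^nc(1/x)$. *)

theory Defs
  imports
    Complex_Main
    "HOL-Computational_Algebra.Polynomial"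
    "HOL-Computational_Algebra.Polynomial_FPS"
    "HOL-Computational_Algebra.Formal_Power_Series"
begin

definition polys_le :: "nat \<Rightarrow> complex poly set" where
  "polys_le n = {c. degree c \<le> n}"

text \<open>
  The identity defining $F_n$ on monomials is an identity of formal power series. The series below
  is linear in \<open>c\<close>, so this is the linear extension from $x^p$ to all polynomials;
  \<open>poly (monom 1 p) 0 = 0 ^ p\<close> respects the convention $0^0 = 1$.
\<close>
definition F_series :: "nat \<Rightarrow> complex poly \<Rightarrow> complex fps" where
  "F_series n c = (1 - fps_X) ^ (2 * n + 1) *
     Abs_fps (\<lambda>m. poly c (of_nat m) * of_nat ((m + n) choose n))"

text \<open>The description operator is justified by \<open>fps_of_poly_F\<close> below.\<close>
definition F :: "nat \<Rightarrow> complex poly \<Rightarrow> complex poly" where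
  "F n c = (THE q. fps_of_poly q = F_series n c)"

text \<open>This is a genuine two-sided inverse on \<open>polys_le n\<close>, see \<open>bij_betw_F\<close>,
  and is given by the closed formula \<open>poly_Finv_monom\<close>.\<close>
definition Finv :: "nat \<Rightarrow> complex poly \<Rightarrow> complex poly" where
  "Finv n = inv_into (polys_le n) (F n)"

definition shift :: "complex \<Rightarrow> complex poly \<Rightarrow> complex poly" where
  "shift \<gamma> c = pcompose c [:\<gamma>, 1:]"

text \<open>The reversal is with respect to the formal degree \<open>n\<close>, so it differs from
  \<^const>\<open>reflect_poly\<close> when \<open>degree c < n\<close>.\<close>
definition J :: "nat \<Rightarrow> complex poly \<Rightarrow> complex poly" where
  "J n c = (\<Sum>i\<le>n. monom (coeff c i) (n - i))"

definition H :: "nat \<Rightarrow> complex \<Rightarrow> complex poly \<Rightarrow> complex poly" where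
  "H n \<beta> = F n \<circ> shift (of_nat n * \<beta>) \<circ> Finv n"

lemma poly_shift: "poly (shift \<gamma> c) x = poly c (x + \<gamma>)"
  by (simp add: shift_def poly_pcompose add.commute)

lemma poly_J:
  assumes "c \<in> polys_le n" "x \<noteq> 0"
  shows "poly (J n c) x = x ^ n * poly c (1 / x)"
proof -
  have "poly c (1 / x) = (\<Sum>i\<le>n. coeff c i * (1 / x) ^ i)"
    using assms(1) unfolding poly_altdef polys_le_def
    by (intro sum.mono_neutral_left) (auto simp: coeff_eq_0)
  then show ?thesis
    using assms(2)
    by (auto simp: J_def poly_sum poly_monom sum_distrib_left power_diff field_simps intro!: sum.cong)
qed

definition F_dual :: "nat \<Rightarrow> nat \<Rightarrow> complex poly" where
  "F_dual n p = smult (fact n / fact (2 * n))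
     ((\<Prod>i<p. [:- of_nat i, 1:]) * (\<Prod>j<n - p. [:of_nat (n + 1 + j), 1:]))"

lemma poly_F_dual:
  "poly (F_dual n p) x = fact n / fact (2 * n) *
     ((\<Prod>i<p. x - of_nat i) * pochhammer (x + of_nat n + 1) (n - p))"
  by (simp add: F_dual_def poly_prod pochhammer_prod atLeast0LessThan algebra_simps)

lemma degree_F_dual:
  assumes "p \<le> n"
  shows "degree (F_dual n p) \<le> n"
proof -
  have a: "degree (\<Prod>i<k. [:f i, 1:]) \<le> k" for k :: nat and f :: "nat \<Rightarrow> complex"
    by (rule order.trans[OF degree_prod_sum_le]) auto
  have "degree ((\<Prod>i<p. [:- of_nat i, 1:]) * (\<Prod>j<n - p. [:of_nat (n + 1 + j), 1:]) :: complex poly)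
     \<le> p + (n - p)"
    by (rule order.trans[OF degree_mult_le]) (intro add_mono a)
  then show ?thesis
    using assms unfolding F_dual_def by simp
qed

lemma prod_falling_fact:
  "p \<le> m \<Longrightarrow> (\<Prod>i<p. of_nat m - of_nat i :: complex) * fact (m - p) = fact m"
proof (induction p)
  case (Suc p)
  have "fact (m - p) = (of_nat m - of_nat p :: complex) * fact (m - Suc p)"
    using Suc.prems by (simp add: fact_reduce[of "m - p"] of_nat_diff)
  then show ?case using Suc by (simp add: mult_ac)
qed simp

lemma poly_F_dual_of_nat:
  assumes "p \<le> n"
  shows "poly (F_dual n p) (of_nat m) * of_nat ((m + n) choose n) =
    (if p \<le> m then of_nat ((m - p + 2 * n) choose (2 * n)) else 0)"
proof (cases "p \<le> m")
  case True
  have a: "(\<Prod>i<p. of_nat m - of_nat i :: complex) = fact m / fact (m - p)"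
    using prod_falling_fact[OF True] by (simp add: field_simps)
  have "pochhammer (1 :: complex) ((m + n) + (n - p)) =
      pochhammer 1 (m + n) * pochhammer (1 + of_nat (m + n)) (n - p)"
    by (rule pochhammer_product')
  also have "(m + n) + (n - p) = m - p + 2 * n" using assms True by simp
  finally have b: "pochhammer (of_nat m + of_nat n + 1 :: complex) (n - p) =
      fact (m - p + 2 * n) / fact (m + n)"
    unfolding pochhammer_fact[symmetric] by (simp add: eq_divide_eq ac_simps)
  have c: "(of_nat ((m + n) choose n) :: complex) = fact (m + n) / (fact n * fact m)"
    using binomial_fact[of n "m + n", where ?'a = complex] by simp
  have d: "(of_nat ((m - p + 2 * n) choose (2 * n)) :: complex) =
      fact (m - p + 2 * n) / (fact (2 * n) * fact (m - p))"
    using binomial_fact[of "2 * n" "m - p + 2 * n", where ?'a = complex] by simp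
  have "poly (F_dual n p) (of_nat m) * of_nat ((m + n) choose n) =
      fact (m - p + 2 * n) / (fact (2 * n) * fact (m - p))"
    unfolding poly_F_dual a b c by simp
  then show ?thesis using True d by presburger
next
  case False
  then have "(\<Prod>i<p. of_nat m - of_nat i :: complex) = 0"
    by (intro prod_zero) (auto intro!: bexI[of _ m])
  then show ?thesis using False by (simp add: poly_F_dual)
qed

lemma F_series_F_dual:
  assumes "p \<le> n"
  shows "F_series n (F_dual n p) = fps_X ^ p"
proof -
  define B :: "complex fps" where "B = Abs_fps (\<lambda>k. of_nat ((k + 2 * n) choose (2 * n)))"
  have choose: "(2 * n + 1 + k - 1) choose k = (k + 2 * n) choose (2 * n)" for k
    using binomial_symmetric[of k "k + 2 * n"] by (simp add: add.commute)
  have "inverse ((1 - fps_const 1 * fps_X :: complex fps) ^ (2 * n + 1)) = B"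
    using one_minus_const_fps_X_neg_power'[of "2 * n + 1" "1 :: complex"]
    unfolding B_def choose by simp
  then have B: "inverse ((1 - fps_X :: complex fps) ^ (2 * n + 1)) = B"
    unfolding fps_const_1_eq_1 mult_1 .
  have "fps_nth ((1 - fps_X :: complex fps) ^ (2 * n + 1)) 0 \<noteq> 0"
    by (simp only: fps_nth_power_0) simp
  then have inv: "(1 - fps_X) ^ (2 * n + 1) * B = 1"
    using inverse_mult_eq_1'[of "(1 - fps_X :: complex fps) ^ (2 * n + 1)"] unfolding B by blast
  have "Abs_fps (\<lambda>m. poly (F_dual n p) (of_nat m) * of_nat ((m + n) choose n)) = fps_X ^ p * B"
    using assms by (simp add: fps_eq_iff poly_F_dual_of_nat B_def fps_X_power_mult_nth)
  then show ?thesis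
    unfolding F_series_def by (simp only: mult.left_commute[of _ "fps_X ^ p"] inv mult_1_right)
qed

lemma F_series_add: "F_series n (c + d) = F_series n c + F_series n d"
proof -
  have "Abs_fps (\<lambda>m. poly (c + d) (of_nat m) * of_nat ((m + n) choose n)) =
      Abs_fps (\<lambda>m. poly c (of_nat m) * of_nat ((m + n) choose n)) +
      Abs_fps (\<lambda>m. poly d (of_nat m) * of_nat ((m + n) choose n))"
    by (simp add: fps_eq_iff algebra_simps)
  then show ?thesis unfolding F_series_def by (simp only: distrib_left)
qed

lemma F_series_smult: "F_series n (smult a c) = fps_const a * F_series n c"
proof -
  have "Abs_fps (\<lambda>m. poly (smult a c) (of_nat m) * of_nat ((m + n) choose n)) =
      fps_const a * Abs_fps (\<lambda>m. poly c (of_nat m) * of_nat ((m + n) choose n))"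
    by (simp add: fps_eq_iff algebra_simps)
  then show ?thesis unfolding F_series_def by (simp only: mult.left_commute)
qed

lemma F_series_sum: "F_series n (\<Sum>p\<in>A. c p) = (\<Sum>p\<in>A. F_series n (c p))"
proof (induction A rule: infinite_finite_induct)
  case (insert x A)
  then show ?case by (simp add: F_series_add)
qed (use F_series_smult[of n 0 0] in simp_all)

lemma F_series_combination:
  "F_series n (\<Sum>p\<le>n. smult (coeff q p) (F_dual n p)) =
     fps_of_poly (\<Sum>p\<le>n. monom (coeff q p) p)"
  by (simp add: F_series_sum F_series_smult F_series_F_dual fps_of_poly_sum fps_of_poly_monom)

lemma monom_expansion: "q \<in> polys_le n \<Longrightarrow> (\<Sum>p\<le>n. monom (coeff q p) p) = q"
  unfolding polys_le_def by (simp add: poly_as_sum_of_monoms')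

lemma F_dual_combination_in:
  "(\<Sum>p\<le>n. smult (a p) (F_dual n p)) \<in> polys_le n"
  unfolding polys_le_def
  by (auto intro!: degree_sum_le order.trans[OF degree_smult_le] degree_F_dual)

lemma F_dual_interpolation:
  assumes "k \<le> n + 1"
  shows "\<exists>a. \<forall>m<k. poly (\<Sum>p<k. smult (a p) (F_dual n p)) (of_nat m) = poly c (of_nat m)"
  using assms
proof (induction k)
  case (Suc k)
  then obtain a where
    a: "\<forall>m<k. poly (\<Sum>p<k. smult (a p) (F_dual n p)) (of_nat m) = poly c (of_nat m)" by auto
  have k: "k \<le> n" using Suc.prems by simp
  have z: "poly (F_dual n k) (of_nat m) = 0" if "m < k" for m
    using poly_F_dual_of_nat[OF k, of m] that by simp
  have nz: "poly (F_dual n k) (of_nat k) \<noteq> 0"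
    using poly_F_dual_of_nat[OF k, of k] by auto
  define s where "s = (\<Sum>p<k. smult (a p) (F_dual n p))"
  define b where "b = (poly c (of_nat k) - poly s (of_nat k)) / poly (F_dual n k) (of_nat k)"
  have s: "(\<Sum>p<Suc k. smult ((a(k := b)) p) (F_dual n p)) = s + smult b (F_dual n k)"
    unfolding s_def by simp
  have "\<forall>m<Suc k. poly (s + smult b (F_dual n k)) (of_nat m) = poly c (of_nat m)"
    using a nz by (auto simp: less_Suc_eq z b_def s_def[symmetric])
  then show ?case by (metis s)
qed simp

lemma F_dual_span:
  assumes "c \<in> polys_le n"
  obtains a where "c = (\<Sum>p\<le>n. smult (a p) (F_dual n p))"
proof -
  from F_dual_interpolation[of "n + 1" n c] obtain a where
    a: "\<forall>m<n + 1. poly (\<Sum>p<n + 1. smult (a p) (F_dual n p)) (of_nat m) = poly c (of_nat m)"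
    by auto
  have "c = (\<Sum>p\<le>n. smult (a p) (F_dual n p))"
  proof (rule poly_eqI_degree[where A = "of_nat ` {..n}"])
    show "poly c x = poly (\<Sum>p\<le>n. smult (a p) (F_dual n p)) x" if "x \<in> of_nat ` {..n}" for x
      using that a by (auto simp: lessThan_Suc_atMost less_Suc_eq_le)
    have "card (of_nat ` {..n} :: complex set) = n + 1"
      by (subst card_image) (auto simp: inj_on_def)
    then show "degree c < card (of_nat ` {..n} :: complex set)"
      "degree (\<Sum>p\<le>n. smult (a p) (F_dual n p)) < card (of_nat ` {..n} :: complex set)"
      using assms F_dual_combination_in[of a n] by (auto simp: polys_le_def)
  qed
  then show thesis by (rule that)
qed

lemma F_eqI: "F_series n c = fps_of_poly q \<Longrightarrow> F n c = q"
  unfolding F_def by (rule the_equality) (auto simp: fps_of_poly_eq_iff)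

lemma F_dual_combination:
  assumes "q \<in> polys_le n"
  shows "F n (\<Sum>p\<le>n. smult (coeff q p) (F_dual n p)) = q"
  by (rule F_eqI) (simp add: F_series_combination monom_expansion[OF assms])

lemma polys_le_dual_form:
  assumes "c \<in> polys_le n"
  obtains q where "q \<in> polys_le n" "c = (\<Sum>p\<le>n. smult (coeff q p) (F_dual n p))"
proof -
  obtain a where a: "c = (\<Sum>p\<le>n. smult (a p) (F_dual n p))"
    using F_dual_span[OF assms] .
  define q where "q = (\<Sum>p\<le>n. monom (a p) p)"
  have "degree q \<le> n"
    unfolding q_def by (auto intro!: degree_sum_le order.trans[OF degree_monom_le])
  moreover have "coeff q p = a p" if "p \<le> n" for p
    using that by (simp add: q_def coeff_sum)
  ultimately show thesis
    using that[of q] a by (simp add: polys_le_def)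
qed

lemma fps_of_poly_F:
  assumes "c \<in> polys_le n"
  shows "fps_of_poly (F n c) = F_series n c"
proof -
  obtain q where "q \<in> polys_le n" "c = (\<Sum>p\<le>n. smult (coeff q p) (F_dual n p))"
    using polys_le_dual_form[OF assms] .
  then show ?thesis
    by (metis F_dual_combination F_series_combination monom_expansion)
qed

lemma bij_betw_F: "bij_betw (F n) (polys_le n) (polys_le n)"
proof (rule bij_betw_byWitness[where f' = "\<lambda>q. \<Sum>p\<le>n. smult (coeff q p) (F_dual n p)"])
  have inv: "F n c \<in> polys_le n \<and> (\<Sum>p\<le>n. smult (coeff (F n c) p) (F_dual n p)) = c"
    if c: "c \<in> polys_le n" for c
  proof -
    obtain q where q: "q \<in> polys_le n" "c = (\<Sum>p\<le>n. smult (coeff q p) (F_dual n p))"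
      using polys_le_dual_form[OF c] .
    then have "F n c = q" using F_dual_combination by blast
    with q show ?thesis by simp
  qed
  then show "\<forall>c\<in>polys_le n. (\<Sum>p\<le>n. smult (coeff (F n c) p) (F_dual n p)) = c"
    and "F n ` polys_le n \<subseteq> polys_le n" by blast+
  show "\<forall>q\<in>polys_le n. F n (\<Sum>p\<le>n. smult (coeff q p) (F_dual n p)) = q"
    using F_dual_combination by blast
  show "(\<lambda>q. \<Sum>p\<le>n. smult (coeff q p) (F_dual n p)) ` polys_le n \<subseteq> polys_le n"
    using F_dual_combination_in by blast
qed

lemma poly_Finv_monom:
  assumes "p \<le> n"
  shows "poly (Finv n (monom 1 p)) x = fact n / fact (2 * n) *
    ((\<Prod>i<p. x - of_nat i) * pochhammer (x + of_nat n + 1) (n - p))"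
proof -
  have "F n (F_dual n p) = monom 1 p"
    by (rule F_eqI) (simp add: F_series_F_dual[OF assms] fps_of_poly_monom)
  moreover have "F_dual n p \<in> polys_le n"
    using degree_F_dual[OF assms] by (simp add: polys_le_def)
  ultimately have "Finv n (monom 1 p) = F_dual n p"
    unfolding Finv_def using bij_betw_F[of n] by (metis bij_betw_def inv_into_f_f)
  then show ?thesis by (simp add: poly_F_dual)
qed

lemma H_in_polys_le:
  assumes "c \<in> polys_le n"
  shows "H n \<beta> c \<in> polys_le n"
proof -
  have "Finv n c \<in> polys_le n"
    unfolding Finv_def using assms bij_betw_F[of n] by (metis bij_betw_def inv_into_into)
  then have "shift \<gamma> (Finv n c) \<in> polys_le n" for \<gamma>
    by (simp add: polys_le_def shift_def degree_pcompose)
  then show ?thesis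
    using bij_betw_F[of n] by (auto simp: H_def bij_betw_def)
qed

end

theory Submission
  imports Defs
begin

text \<open>
  The reflection \<open>c(x) \<mapsto> (-1)\<^sup>n c(-1-n-x)\<close> exchanges the polynomials \<open>(x)\<^sub>p [x+n+1]\<^bsub>n-p\<^esub>\<close> for
  \<open>p\<close> and \<open>n-p\<close>, so \<open>F\<^sub>n\<close> conjugates it into \<open>J\<^sub>n\<close>. As a reflection it conjugates the
  shift by \<open>\<gamma>\<close> into the shift by \<open>-\<gamma>\<close>.
\<close>

definition reflection :: "nat \<Rightarrow> complex poly \<Rightarrow> complex poly" where
  "reflection n c = smult ((- 1) ^ n) (pcompose c [:- 1 - of_nat n, - 1:])"

lemma poly_reflection: "poly (reflection n c) x = (- 1) ^ n * poly c (- 1 - of_nat n - x)"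
  by (simp add: reflection_def poly_pcompose)

lemma reflection_combination:
  "reflection n (\<Sum>p\<in>A. smult (a p) (c p)) = (\<Sum>p\<in>A. smult (a p) (reflection n (c p)))"
  by (rule poly_eq_poly_eq_iff[THEN iffD1])
     (simp add: fun_eq_iff poly_reflection poly_sum sum_distrib_left mult_ac)

lemma reflection_in_polys_le: "c \<in> polys_le n \<Longrightarrow> reflection n c \<in> polys_le n"
  by (simp add: polys_le_def reflection_def degree_pcompose)

lemma shift_in_polys_le: "c \<in> polys_le n \<Longrightarrow> shift \<gamma> c \<in> polys_le n"
  by (simp add: polys_le_def shift_def degree_pcompose)

text \<open>The two substitutions x -> -1-n-x cancel, but the second one negates the \<gamma>
  inserted between them; the signs square to 1.\<close>

lemma reflection_shift_reflection: "reflection n (shift \<gamma> (reflection n c)) = shift (- \<gamma>) c"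
  by (rule poly_eq_poly_eq_iff[THEN iffD1])
     (simp add: fun_eq_iff poly_reflection poly_shift mult.assoc[symmetric] power_add[symmetric]
        flip: mult_2)

text \<open>The roots of \<open>F_dual n p\<close> are 0, ..., p-1 and -(n+1), ..., -(2n-p). The map
  x -> -1-n-x carries them to -(n+1), ..., -(n+p) and 0, ..., n-p-1; the factor (-1)^n keeps the
  leading coefficient.\<close>

lemma reflection_F_dual:
  assumes "p \<le> n"
  shows "reflection n (F_dual n p) = F_dual n (n - p)"
proof -
  have falling: "(\<Prod>i<k. y - of_nat i) = (- 1) ^ k * pochhammer (- y) k" for k and y :: complex
    by (induction k) (simp_all add: pochhammer_Suc algebra_simps)
  have "poly (reflection n (F_dual n p)) x = poly (F_dual n (n - p)) x" for x
  proof -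
    have "(\<Prod>i<p. - 1 - of_nat n - x - of_nat i) = (- 1) ^ p * pochhammer (x + of_nat n + 1) p"
      unfolding falling by (simp add: algebra_simps)
    moreover have "(\<Prod>i<n - p. x - of_nat i) = (- 1) ^ (n - p) * pochhammer (- x) (n - p)"
      by (rule falling)
    \<comment> \<open>The signs of \<open>reflection\<close> and of the reflected falling product
      combine to the one that turns \<open>pochhammer (- x) (n - p)\<close> into a falling
      product.\<close>
    moreover have "(- 1 :: complex) ^ n * (- 1) ^ p = (- 1) ^ (n - p)"
    proof -
      have "(- 1 :: complex) ^ n = (- 1) ^ (n - p) * (- 1) ^ p"
        using assms by (simp flip: power_add)
      then show ?thesis by (simp add: mult.assoc flip: power_mult_distrib)
    qed
    ultimately show ?thesis
      using assms by (simp add: poly_reflection poly_F_dual mult_ac)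
  qed
  then show ?thesis by (simp add: poly_eq_poly_eq_iff[symmetric] fun_eq_iff)
qed

lemma coeff_J: "p \<le> n \<Longrightarrow> coeff (J n c) p = coeff c (n - p)"
proof -
  assume "p \<le> n"
  then have "(n - i = p) = (i = n - p)" if "i \<le> n" for i using that by auto
  then have "coeff (J n c) p = (\<Sum>i\<le>n. if i = n - p then coeff c i else 0)"
    by (auto simp: J_def coeff_sum intro!: sum.cong)
  then show ?thesis by simp
qed

lemma J_in_polys_le: "J n c \<in> polys_le n"
  unfolding J_def polys_le_def
  by (auto intro!: degree_sum_le order.trans[OF degree_monom_le])

lemma F_Finv: "c \<in> polys_le n \<Longrightarrow> F n (Finv n c) = c"
  using bij_betw_F[of n] unfolding Finv_def by (metis bij_betw_def f_inv_into_f)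

lemma Finv_F: "c \<in> polys_le n \<Longrightarrow> Finv n (F n c) = c"
  using bij_betw_F[of n] unfolding Finv_def by (metis bij_betw_def inv_into_f_f)

lemma F_in_polys_le: "c \<in> polys_le n \<Longrightarrow> F n c \<in> polys_le n"
  using bij_betw_F[of n] by (auto simp: bij_betw_def)

lemma Finv_in_polys_le: "c \<in> polys_le n \<Longrightarrow> Finv n c \<in> polys_le n"
  using bij_betw_F[of n] unfolding Finv_def by (metis bij_betw_def inv_into_into)

text \<open>\<open>Finv\<close> merely selects preimages. The right side is a preimage of
  \<open>c\<close>, and \<open>F n\<close> is injective on \<open>polys_le n\<close>, so
  \<open>Finv\<close> becomes explicitly linear.\<close>

lemma Finv_eq: "c \<in> polys_le n \<Longrightarrow> Finv n c = (\<Sum>p\<le>n. smult (coeff c p) (F_dual n p))"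
  by (metis F_dual_combination F_dual_combination_in Finv_F)

lemma Finv_J:
  assumes "c \<in> polys_le n"
  shows "Finv n (J n c) = reflection n (Finv n c)"
proof -
  have "Finv n (J n c) = (\<Sum>p\<le>n. smult (coeff c (n - p)) (F_dual n p))"
    by (simp add: Finv_eq J_in_polys_le coeff_J)
  also have "\<dots> = (\<Sum>p\<le>n. smult (coeff c p) (F_dual n (n - p)))"
    \<comment> \<open>The map p -> n-p is its own inverse on 0, ..., n.\<close>
    by (rule sum.reindex_bij_witness[of _ "\<lambda>p. n - p" "\<lambda>p. n - p"]) auto
  also have "\<dots> = reflection n (Finv n c)"
    by (simp add: Finv_eq assms reflection_combination reflection_F_dual)
  finally show ?thesis .
qed

lemma J_F: "c \<in> polys_le n \<Longrightarrow> J n (F n c) = F n (reflection n c)"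
  by (metis F_Finv F_in_polys_le Finv_F Finv_J J_in_polys_le)

theorem theorem7p1:
  fixes n :: nat and \<beta> :: complex
  shows "\<forall>c\<in>polys_le n. H n (- \<beta>) c = (J n \<circ> H n \<beta> \<circ> J n) c"
  \<comment> \<open>Moving both \<open>J n\<close> inwards leaves the shift by n\<beta> between two
    reflections, acting on \<open>Finv n c\<close>; the membership lemmas license these
    rewrites.\<close>
  by (simp add: H_def Finv_J J_F reflection_in_polys_le shift_in_polys_le Finv_in_polys_le
      reflection_shift_reflection)

end
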